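(* Let $G=(V,E)$ be a directed graph with $V=\{1,\dots,n\}$ and $|E|=m$, and for each arc $(i,j)\in E$ let $\hat q_{ij}$ be a unit dual quaternion. For $\hat{\mathbf x}=(\hat x_1,\dots,\hat x_n)\in\hat{\mathbb Q}^n$ put $\hat e_{ij}=\hat q_{ij}-\hat x_i^*\hat x_j$ for $(i,j)\in E$ and $\hat{\mathbf e}=(\hat e_{ij}:(i,j)\in E)\in\hat{\mathbb Q}^m$. Then the pose graph optimization problem $$\min\{\|\hat{\mathbf e}\|_2 : |\hat x_i|^2=1,\ i=1,\dots,n\}$$ is an equality constrained standard dual quaternion optimization problem; that is, the objective function $\hat{\mathbf x}\mapsto\|\hat{\mathbf e}\|_2$ and the constraint functions $\hat{\mathbf x}\mapsto|\hat x_i|^2-1$, $i=1,\dots,n$, are all standard dual quaternion functions on $\hat{\mathbb Q}^n$.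
   Context: Dual numbers: $\hat{\mathbb R}$ is the set of $q+q_d\epsilon$ with $q,q_d\in\mathbb R$, $\epsilon^2=0$; $q$ is the standard part, $q_d$ the dual part. Dual quaternions: $\hat{\mathbb Q}$ is the set of $\hat q=q+q_d\epsilon$ with $q,q_d\in\mathbb Q$, the real quaternions (note: $\mathbb Q$ denotes quaternions here), where $\epsilon$ commutes with quaternions; addition is componentwise and $(p+p_d\epsilon)(q+q_d\epsilon)=pq+(pq_d+p_dq)\epsilon$. The conjugate is $\hat q^*=q^*+q_d^*\epsilon$. $\hat q$ is infinitesimal if $q=0$. The magnitude of $\hat q$ is the dual number $|\hat q|=|q|+\frac{qq_d^*+q_dq^*}{2|q|}\epsilon$ if $q\neq0$, and $|\hat q|=|q_d|\epsilon$ otherwise. $\hat q$ is a unit dual quaternion if $|\hat q|=1$. The $2$-norm of $\hat{\mathbf z}=(\hat z_1,\dots,\hat z_m)\in\hat{\mathbb Q}^m$ is the dual number $\|\hat{\mathbf z}\|_2=\sqrt{\sum_{i}|\hat z_i|^2}$ if not all $\hat z_i$ are infinitesimal (where $\sqrt{a+b\epsilon}=\sqrt a+\frac{b}{2\sqrt a}\epsilon$ for real $a>0$, $b$), and $\|\hat{\mathbf z}\|_2=\sqrt{\sum_i|(z_i)_d|^2}\,\epsilon$ if all $\hat z_i=(z_i)_d\epsilon$ are infinitesimal. For $\hat{\mathbf x}\in\hat{\mathbb Q}^n$ write $\hat{\mathbf x}=\mathbf x+\epsilon\mathbf x_d$ with $\mathbf x,\mathbf x_d\in\mathbb Q^n$,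 and identify $\mathbf x$ with $\mathbf x+\epsilon\mathbf 0$. A dual quaternion function $\hat f:\hat{\mathbb Q}^n\to\hat{\mathbb R}$, $\hat f(\hat{\mathbf x})=f(\hat{\mathbf x})+\epsilon f_d(\hat{\mathbf x})$ with $f(\hat{\mathbf x}),f_d(\hat{\mathbf x})\in\mathbb R$, is standard if $f(\hat{\mathbf x})=f(\mathbf x)$ for all $\hat{\mathbf x}$. An equality constrained standard dual quaternion optimization problem is a problem $\min\{\hat f(\hat{\mathbf x}):\hat h_j(\hat{\mathbf x})=0,\ j=1,\dots,k\}$ over $\hat{\mathbf x}\in\hat{\mathbb Q}^n$ (with respect to the order on $\hat{\mathbb R}$: $p+p_d\epsilon\le q+q_d\epsilon$ iff $p<q$, or $p=q$ and $p_d\le q_d$) in which $\hat f,\hat h_1,\dots,\hat h_k$ are all standard dual quaternion functions. *)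

theory Defs
  imports "HOL-Analysis.Finite_Cartesian_Product"
begin

section \<open>Quaternions\<close>

datatype quat = Quat (Re0: real) (Im1: real) (Im2: real) (Im3: real)

lemma quat_eq_iff:
  "p = q \<longleftrightarrow> Re0 p = Re0 q \<and> Im1 p = Im1 q \<and> Im2 p = Im2 q \<and> Im3 p = Im3 q"
  by (auto intro: quat.expand)

instantiation quat :: real_algebra_1
begin

definition "0 = Quat 0 0 0 0"
definition "1 = Quat 1 0 0 0"
definition "p + q = Quat (Re0 p + Re0 q) (Im1 p + Im1 q) (Im2 p + Im2 q) (Im3 p + Im3 q)"
definition "- p = Quat (- Re0 p) (- Im1 p) (- Im2 p) (- Im3 p)"
definition "p - q = Quat (Re0 p - Re0 q) (Im1 p - Im1 q) (Im2 p - Im2 q) (Im3 p - Im3 q)"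
definition "p * q = Quat
  (Re0 p * Re0 q - Im1 p * Im1 q - Im2 p * Im2 q - Im3 p * Im3 q)
  (Re0 p * Im1 q + Im1 p * Re0 q + Im2 p * Im3 q - Im3 p * Im2 q)
  (Re0 p * Im2 q - Im1 p * Im3 q + Im2 p * Re0 q + Im3 p * Im1 q)
  (Re0 p * Im3 q + Im1 p * Im2 q - Im2 p * Im1 q + Im3 p * Re0 q)"
definition "r *\<^sub>R p = Quat (r * Re0 p) (r * Im1 p) (r * Im2 p) (r * Im3 p)"

lemmas quat_arith_defs = zero_quat_def one_quat_def plus_quat_def uminus_quat_def
  minus_quat_def times_quat_def scaleR_quat_def

instance
  by standard (simp_all add: quat_arith_defs algebra_simps)

end

definition quat_norm :: "quat \<Rightarrow> real"
  where "quat_norm q = sqrt ((Re0 q)\<^sup>2 + (Im1 q)\<^sup>2 + (Im2 q)\<^sup>2 + (Im3 q)\<^sup>2)"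

definition quat_cnj :: "quat \<Rightarrow> quat"
  where "quat_cnj q = Quat (Re0 q) (- Im1 q) (- Im2 q) (- Im3 q)"


section \<open>Dual numbers and dual quaternions\<close>

datatype 'a dual = Dual (std_part: 'a) (dual_part: 'a)

type_synonym dual_number = "real dual"
type_synonym dual_quat = "quat dual"

lemma dual_eq_iff: "x = y \<longleftrightarrow> std_part x = std_part y \<and> dual_part x = dual_part y"
  by (auto intro: dual.expand)

instantiation dual :: (ring_1) ring_1
begin

definition "0 = Dual 0 0"
definition "1 = Dual 1 0"
definition "x + y = Dual (std_part x + std_part y) (dual_part x + dual_part y)"
definition "- x = Dual (- std_part x) (- dual_part x)"
definition "x - y = Dual (std_part x - std_part y) (dual_part x - dual_part y)"
definition "x * y = Dual (std_part x * std_part y)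
  (std_part x * dual_part y + dual_part x * std_part y)"

lemmas dual_arith_defs = zero_dual_def one_dual_def plus_dual_def uminus_dual_def
  minus_dual_def times_dual_def

instance
  by standard (simp_all add: dual_arith_defs algebra_simps)

end

instance dual :: (comm_ring_1) comm_ring_1
  by standard (simp_all add: dual_arith_defs algebra_simps)

instantiation dual :: (linorder) linorder
begin

definition "x \<le> y \<longleftrightarrow>
  std_part x < std_part y \<or> std_part x = std_part y \<and> dual_part x \<le> dual_part y"
definition "x < y \<longleftrightarrow>
  std_part x < std_part y \<or> std_part x = std_part y \<and> dual_part x < dual_part y"

instance
  by standard (auto simp: less_eq_dual_def less_dual_def dual_eq_iff)

end

text \<open>Only meaningful for a positive standard part.\<close>

definition dual_sqrt :: "dual_number \<Rightarrow> dual_number"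
  where "dual_sqrt a = Dual (sqrt (std_part a)) (dual_part a / (2 * sqrt (std_part a)))"

definition dq_cnj :: "dual_quat \<Rightarrow> dual_quat"
  where "dq_cnj q = Dual (quat_cnj (std_part q)) (quat_cnj (dual_part q))"

definition infinitesimal :: "dual_quat \<Rightarrow> bool"
  where "infinitesimal q \<longleftrightarrow> std_part q = 0"

text \<open>The numerator of the dual part of the magnitude is a quaternion with vanishing imaginary
  parts; \<^const>\<open>Re0\<close> turns it into a real number without loss.\<close>

lemma magnitude_numerator_real:
  "p * quat_cnj q + q * quat_cnj p = of_real (Re0 (p * quat_cnj q + q * quat_cnj p))"
  by (simp add: of_real_def quat_arith_defs quat_cnj_def)

definition dq_magnitude :: "dual_quat \<Rightarrow> dual_number"
  where "dq_magnitude q =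
    (if \<not> infinitesimal q
     then Dual (quat_norm (std_part q))
       (Re0 (std_part q * quat_cnj (dual_part q) + dual_part q * quat_cnj (std_part q))
         / (2 * quat_norm (std_part q)))
     else Dual 0 (quat_norm (dual_part q)))"

definition unit_dual_quat :: "dual_quat \<Rightarrow> bool"
  where "unit_dual_quat q \<longleftrightarrow> dq_magnitude q = 1"

text \<open>The 2-norm of a vector whose entries are indexed by a finite set \<open>I\<close>.\<close>

definition dq_norm2 :: "'i set \<Rightarrow> ('i \<Rightarrow> dual_quat) \<Rightarrow> dual_number"
  where "dq_norm2 I z =
    (if \<exists>i\<in>I. \<not> infinitesimal (z i)
     then dual_sqrt (\<Sum>i\<in>I. (dq_magnitude (z i))\<^sup>2)
     else Dual 0 (sqrt (\<Sum>i\<in>I. (quat_norm (dual_part (z i)))\<^sup>2)))"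


section \<open>Standard dual quaternion functions and optimization problems\<close>

text \<open>The standard part \<open>\<^bold>x\<close> of a vector, identified with \<open>\<^bold>x + \<epsilon>\<^bold>0\<close>.\<close>

definition std_vec :: "dual_quat ^ 'n::finite \<Rightarrow> dual_quat ^ 'n"
  where "std_vec x = (\<chi> i. Dual (std_part (x $ i)) 0)"

definition standard_dq_function :: "(dual_quat ^ 'n::finite \<Rightarrow> dual_number) \<Rightarrow> bool"
  where "standard_dq_function f \<longleftrightarrow> (\<forall>x. std_part (f x) = std_part (f (std_vec x)))"

text \<open>The problem of minimizing \<open>objective P x\<close> subject to \<open>constraint P j x = 0\<close> for all
  \<open>j :: 'k\<close>, where \<open>k = CARD('k)\<close>.\<close>

datatype ('n::finite, 'k) dq_problem =
  DQ_Problem (objective: "dual_quat ^ 'n \<Rightarrow> dual_number")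
    (constraint: "'k \<Rightarrow> dual_quat ^ 'n \<Rightarrow> dual_number")

definition feasible_set :: "('n::finite, 'k::finite) dq_problem \<Rightarrow> (dual_quat ^ 'n) set"
  where "feasible_set P = {x. \<forall>j. constraint P j x = 0}"

definition is_minimizer :: "('n::finite, 'k::finite) dq_problem \<Rightarrow> dual_quat ^ 'n \<Rightarrow> bool"
  where "is_minimizer P x \<longleftrightarrow>
    x \<in> feasible_set P \<and> (\<forall>y\<in>feasible_set P. objective P x \<le> objective P y)"

definition standard_dq_problem :: "('n::finite, 'k::finite) dq_problem \<Rightarrow> bool"
  where "standard_dq_problem P \<longleftrightarrow>
    standard_dq_function (objective P) \<and> (\<forall>j. standard_dq_function (constraint P j))"


section \<open>Pose graph optimization\<close>

text \<open>The vertex set is the index type \<open>'n\<close>, and a directed graph is its set of arcs.\<close>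

definition pose_error ::
    "('n::finite \<times> 'n \<Rightarrow> dual_quat) \<Rightarrow> dual_quat ^ 'n \<Rightarrow> 'n \<times> 'n \<Rightarrow> dual_quat"
  where "pose_error q x = (\<lambda>(i, j). q (i, j) - dq_cnj (x $ i) * x $ j)"

definition pose_graph_problem ::
    "('n::finite \<times> 'n) set \<Rightarrow> ('n \<times> 'n \<Rightarrow> dual_quat) \<Rightarrow> ('n, 'n) dq_problem"
  where "pose_graph_problem E q =
    DQ_Problem (\<lambda>x. dq_norm2 E (pose_error q x)) (\<lambda>i x. (dq_magnitude (x $ i))\<^sup>2 - 1)"

end

(* Taking standard parts is a ring homomorphism that commutes with conjugation, and it carries
   the magnitude and the 2-norm to the ordinary quaternion norm and the Euclidean norm: in the
   infinitesimal branches both definitions have standard part 0, which is what the ordinary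
   norms give there. So the standard part of every function built from these operations depends
   on the standard parts of the arguments only. *)

theory Submission imports Defs begin

lemma std_part_ring_simps [simp]:
  "std_part 0 = 0" "std_part 1 = 1"
  "std_part (x + y) = std_part x + std_part y"
  "std_part (x - y) = std_part x - std_part y"
  "std_part (x * y) = std_part x * std_part y"
  by (simp_all add: dual_arith_defs)

lemma std_part_power [simp]: "std_part (x ^ n) = std_part x ^ n"
  by (induction n) simp_all

text \<open>Over an infinite \<open>A\<close> both sums take the default value 0, so additivity
  covers every index set.\<close>

lemma std_part_sum: "std_part (sum f A) = (\<Sum>i\<in>A. std_part (f i))"
  by (induction A rule: infinite_finite_induct) simp_all

lemma std_part_cnj [simp]: "std_part (dq_cnj q) = quat_cnj (std_part q)"
  by (simp add: dq_cnj_def)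

lemma quat_norm_zero [simp]: "quat_norm 0 = 0"
  by (simp add: quat_norm_def zero_quat_def)

lemma std_part_magnitude [simp]: "std_part (dq_magnitude q) = quat_norm (std_part q)"
  by (simp add: dq_magnitude_def infinitesimal_def)

text \<open>A single formula without the case split on \<open>infinitesimal\<close>: error vectors
  with equal standard parts can then be compared by rewriting alone.\<close>

lemma std_part_norm2:
  "std_part (dq_norm2 I z) = sqrt (\<Sum>i\<in>I. (quat_norm (std_part (z i)))\<^sup>2)"
  by (simp add: dq_norm2_def dual_sqrt_def std_part_sum infinitesimal_def)

lemma std_part_std_vec [simp]: "std_part (std_vec x $ i) = std_part (x $ i)"
  by (simp add: std_vec_def)

lemma std_part_pose_error_std_vec:
  "std_part (pose_error q (std_vec x) a) = std_part (pose_error q x a)"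
  by (simp add: pose_error_def split: prod.split)

lemma standard_pose_objective: "standard_dq_function (\<lambda>x. dq_norm2 E (pose_error q x))"
  by (simp add: standard_dq_function_def std_part_norm2 std_part_pose_error_std_vec)

lemma standard_pose_constraint: "standard_dq_function (\<lambda>x. (dq_magnitude (x $ i))\<^sup>2 - 1)"
  by (simp add: standard_dq_function_def)

theorem mainTheorem10:
  fixes E :: "('n::finite \<times> 'n) set"
    and q :: "'n \<times> 'n \<Rightarrow> dual_quat"
  assumes "\<And>i j. (i, j) \<in> E \<Longrightarrow> unit_dual_quat (q (i, j))"
  shows "feasible_set (pose_graph_problem E q) = {x. \<forall>i. (dq_magnitude (x $ i))\<^sup>2 = 1}
    \<and> standard_dq_problem (pose_graph_problem E q)
    \<and> standard_dq_function (\<lambda>x::dual_quat ^ 'n. dq_norm2 E (pose_error q x))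
    \<and> (\<forall>i. standard_dq_function (\<lambda>x::dual_quat ^ 'n. (dq_magnitude (x $ i))\<^sup>2 - 1))"
  \<comment> \<open>The dual numbers form a ring, so each constraint \<open>c - 1 = 0\<close> is
    equivalent to \<open>c = 1\<close>.\<close>
  by (simp add: feasible_set_def standard_dq_problem_def pose_graph_problem_def
      standard_pose_objective standard_pose_constraint)

end
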